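(* Let $K$ be a field and let $I$ and $J$ be equigenerated monomial ideals of height $2$ in $K[x,y]$. Then $\mu(I\cap J)<\mu(IJ)$.
   Context: $\mu(L)$ denotes the minimal number of generators of a monomial ideal $L$. A monomial ideal is equigenerated if it is generated by monomials all of the same degree ($I$ and $J$ may be generated in different degrees). *)

theory Defs
  imports "HOL-Algebra.Algebra" "HOL-Algebra.Algebraic_Closure_Type" "HOL-Library.Extended_Nat"
begin

section \<open>Height and number of generators of an ideal\<close>

text \<open>The height of a prime ideal \<open>P\<close> is the supremum of the lengths \<open>n\<close> of the chains
  \<open>C 0 \<subset> C 1 \<subset> \<dots> \<subset> C n = P\<close> of prime ideals.\<close>

definition prime_height :: "('a, 'b) ring_scheme \<Rightarrow> 'a set \<Rightarrow> enat" where
  "prime_height R P =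
     (SUP n \<in> {n. \<exists>C. (\<forall>i\<le>n. primeideal (C i) R) \<and> (\<forall>i<n. C i \<subset> C (Suc i)) \<and> C n = P}. enat n)"

text \<open>An infimum over the empty set is \<open>\<infinity>\<close>; in particular the unit ideal has height \<open>\<infinity>\<close>.\<close>

definition ideal_height :: "('a, 'b) ring_scheme \<Rightarrow> 'a set \<Rightarrow> enat" where
  "ideal_height R I = (INF P \<in> {P. primeideal P R \<and> I \<subseteq> P}. prime_height R P)"

text \<open>The generators are arbitrary ring elements, not necessarily monomials. The value is \<open>\<infinity>\<close>
  for an ideal that is not finitely generated.\<close>

definition min_gens :: "('a, 'b) ring_scheme \<Rightarrow> 'a set \<Rightarrow> enat" where
  "min_gens R I = (INF S \<in> {S. finite S \<and> S \<subseteq> carrier R \<and> Idl\<^bsub>R\<^esub> S = I}. enat (card S))"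


section \<open>The polynomial ring in two variables\<close>

text \<open>\<open>K[x,y]\<close> is represented as \<open>K[x][y]\<close>: the variable of the inner polynomials is \<open>x\<close>, that of
  the outer ones is \<open>y\<close>.\<close>

abbreviation Kxy :: "'k::field poly poly ring" where
  "Kxy \<equiv> ring_of_type_algebra"

definition var_x :: "'k::field poly poly" where
  "var_x = [:[:0, 1:]:]"

definition var_y :: "'k::field poly poly" where
  "var_y = [:0, 1:]"

definition monomials_of_degree :: "nat \<Rightarrow> 'k::field poly poly set" where
  "monomials_of_degree d = {var_x ^ i * var_y ^ j | i j. i + j = d}"

definition equigenerated_monomial_ideal :: "'k::field poly poly set \<Rightarrow> bool" where
  "equigenerated_monomial_ideal I \<longleftrightarrow> (\<exists>d. \<exists>S \<subseteq> monomials_of_degree d. I = Idl\<^bsub>Kxy\<^esub> S)"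

end

theory Submission
  imports Defs
begin

text \<open>A monomial ideal of \<open>K[x,y]\<close> that is equigenerated in degree \<open>d\<close> is determined by the set \<open>A\<close> of
  the \<open>x\<close>-exponents of its generators \<open>x\<^sup>a y\<^bsup>d-a\<^esup>\<close>. Height \<open>2\<close> means that the ideal is proper and
  contained in neither \<open>(x)\<close> nor \<open>(y)\<close>, which are primes of height at most \<open>1\<close>; hence \<open>0\<close> and \<open>d\<close>
  both belong to \<open>A\<close>, and \<open>d > 0\<close> (\<open>height_2_generators\<close>). Let \<open>B\<close> and \<open>e\<close> be the corresponding
  data of \<open>J\<close>. The inequality follows from the chain
  \<open>\<mu>(I \<inter> J) \<le> |A \<union> B| < |A + B| \<le> \<mu>(IJ)\<close>.

  For the first step, draw \<open>I\<close> and \<open>J\<close> as staircases in the plane of exponents. The staircase of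
  \<open>I \<inter> J\<close> is the pointwise maximum of the two, so it can only step down in a column where one of
  them does, that is, at an \<open>x\<close>-exponent in \<open>A \<union> B\<close> (\<open>min_gens_inter_le\<close>).

  For the second step, \<open>A \<union> B\<close> is contained in \<open>A + B\<close> because \<open>0\<close> lies in both sets, while \<open>d + e\<close>
  lies in \<open>A + B\<close> and exceeds every element of \<open>A \<union> B\<close> (\<open>card_union_less_card_sumset\<close>).

  For the third step, \<open>IJ\<close> lives in degrees at least \<open>d + e\<close>, and contains the monomial of degree
  \<open>d + e\<close> with \<open>x\<close>-exponent \<open>c\<close> for each \<open>c\<close> in \<open>A + B\<close>. In this lowest degree, multiplication by a
  polynomial is multiplication by its constant coefficient, so the lowest components of any
  generators span, as a vector space, a space containing these \<open>|A + B|\<close> linearly independent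
  monomials (\<open>card_le_min_gens\<close>). This covers generators that are not monomials.\<close>

section \<open>Ideals of a ring given by a type\<close>

lemma ring_of_type_algebra_simps [simp]:
  "carrier (ring_of_type_algebra :: 'a::comm_ring_1 ring) = UNIV"
  "x \<otimes>\<^bsub>(ring_of_type_algebra :: 'a ring)\<^esub> y = x * y"
  "x \<oplus>\<^bsub>(ring_of_type_algebra :: 'a ring)\<^esub> y = x + y"
  "\<one>\<^bsub>(ring_of_type_algebra :: 'a ring)\<^esub> = 1"
  "\<zero>\<^bsub>(ring_of_type_algebra :: 'a ring)\<^esub> = 0"
  by (simp_all add: ring_of_type_algebra_def)

lemma ideal_of_type_iff:
  "ideal I (ring_of_type_algebra :: 'a::comm_ring_1 ring) \<longleftrightarrow>
     0 \<in> I \<and> (\<forall>p\<in>I. \<forall>q\<in>I. p + q \<in> I) \<and> (\<forall>p\<in>I. \<forall>r. r * p \<in> I)"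
    (is "?L \<longleftrightarrow> ?R")
proof
  assume ?L
  then interpret ideal I "ring_of_type_algebra :: 'a ring" .
  show ?R
    using additive_subgroup.zero_closed[OF is_additive_subgroup]
      additive_subgroup.a_closed[OF is_additive_subgroup] I_l_closed by auto
next
  assume R: ?R
  interpret R: cring "ring_of_type_algebra :: 'a ring"
    by (rule cring_from_type_algebra)
  show ?L
  proof (rule idealI[OF R.ring_axioms])
    show "subgroup I (add_monoid (ring_of_type_algebra :: 'a ring))"
    proof (rule R.add.subgroupI)
      fix p assume "p \<in> I"
      hence "- 1 * p \<in> I"
        using R by blast
      moreover have "\<ominus>\<^bsub>(ring_of_type_algebra :: 'a ring)\<^esub> p = - p"
        by (rule R.minus_equality) auto
      ultimately show "\<ominus>\<^bsub>(ring_of_type_algebra :: 'a ring)\<^esub> p \<in> I"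
        by simp
    qed (use R in auto)
  qed (use R in \<open>auto simp: mult.commute\<close>)
qed

lemma genideal_of_type_minimal:
  assumes "ideal I (ring_of_type_algebra :: 'a::comm_ring_1 ring)" and "S \<subseteq> I"
  shows "Idl\<^bsub>(ring_of_type_algebra :: 'a ring)\<^esub> S \<subseteq> I"
  using assms by (auto simp: genideal_def)

lemma ideal_genideal_of_type:
  "ideal (Idl\<^bsub>(ring_of_type_algebra :: 'a::comm_ring_1 ring)\<^esub> S) (ring_of_type_algebra :: 'a ring)"
  by (rule ring.genideal_ideal[OF ring_from_type_algebra]) simp

lemma subset_genideal_of_type:
  "S \<subseteq> Idl\<^bsub>(ring_of_type_algebra :: 'a::comm_ring_1 ring)\<^esub> S"
  by (auto simp: genideal_def)

lemma ideal_of_type_sum: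
  assumes "ideal I (ring_of_type_algebra :: 'a::comm_ring_1 ring)" and "\<And>x. x \<in> A \<Longrightarrow> f x \<in> I"
  shows "sum f A \<in> I"
  using assms(2) by (induction A rule: infinite_finite_induct)
    (use assms(1) in \<open>auto simp: ideal_of_type_iff\<close>)

section \<open>Coefficients and monomial ideals\<close>

text \<open>The first index is the exponent of \<open>x\<close>, the second that of \<open>y\<close>. In the nested
  representation the outer variable is \<open>y\<close>, so the two coefficients are taken in the opposite order.\<close>

definition coef :: "'k::field poly poly \<Rightarrow> nat \<Rightarrow> nat \<Rightarrow> 'k" where
  "coef p i j = Polynomial.coeff (Polynomial.coeff p j) i"

definition xy :: "nat \<Rightarrow> nat \<Rightarrow> 'k::field poly poly" where
  "xy i j = var_x ^ i * var_y ^ j"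

lemma xy_eq_monom: "xy i j = Polynomial.monom (Polynomial.monom 1 i) j"
proof -
  have "var_x ^ i = [:Polynomial.monom (1::'a) i:]" for i
    by (induction i) (simp_all add: var_x_def one_pCons monom_0 monom_Suc)
  moreover have "var_y ^ j = Polynomial.monom (1::'a poly) j" for j
    by (simp add: var_y_def Polynomial.monom_altdef)
  ultimately show ?thesis
    by (simp add: xy_def smult_monom)
qed

lemma xy_mult: "xy a b * xy c d = xy (a + c) (b + d)"
  by (simp add: xy_def power_add mult_ac)

lemma coef_add: "coef (p + q) i j = coef p i j + coef q i j"
  and coef_0: "coef 0 i j = 0"
  by (simp_all add: coef_def)

lemma poly_poly_eqI: "(\<And>i j. coef p i j = coef q i j) \<Longrightarrow> p = q"
  by (simp add: coef_def poly_eq_iff)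

lemma coef_mult:
  "coef (p * q) i j = (\<Sum>l\<le>j. \<Sum>k\<le>i. coef p k l * coef q (i - k) (j - l))"
  by (simp add: coef_def coeff_mult Polynomial.coeff_sum)

lemma coef_xy_mult:
  "coef (xy a b * p) i j = (if a \<le> i \<and> b \<le> j then coef p (i - a) (j - b) else 0)"
  by (simp add: coef_def xy_eq_monom Polynomial.coeff_monom_mult)

lemma coef_xy: "coef (xy a b) i j = (if i = a \<and> j = b then 1 else 0)"
  by (auto simp: coef_def xy_eq_monom)

lemma poly_poly_as_sum:
  "p = (\<Sum>j\<le>Polynomial.degree p. \<Sum>i\<le>Polynomial.degree (Polynomial.coeff p j).
          [:[:coef p i j:]:] * xy i j)"
proof -
  have "(\<Sum>i\<le>Polynomial.degree (Polynomial.coeff p j). [:[:coef p i j:]:] * xy i j) =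
          Polynomial.monom (Polynomial.coeff p j) j" for j
  proof -
    have "(\<Sum>i\<le>Polynomial.degree (Polynomial.coeff p j). [:[:coef p i j:]:] * xy i j) =
      (\<Sum>i\<le>Polynomial.degree (Polynomial.coeff p j).
         Polynomial.monom (Polynomial.monom (Polynomial.coeff (Polynomial.coeff p j) i) i) j)"
      by (simp add: coef_def xy_eq_monom smult_monom)
    also have "\<dots> = Polynomial.monom (\<Sum>i\<le>Polynomial.degree (Polynomial.coeff p j).
         Polynomial.monom (Polynomial.coeff (Polynomial.coeff p j) i) i) j"
      by (simp add: monom_sum)
    finally show ?thesis
      by (simp add: poly_as_sum_of_monoms)
  qed
  thus ?thesis
    by (simp add: poly_as_sum_of_monoms)
qed

text \<open>The ideal is described by membership rather than by generators: every monomial that occurs in the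
  polynomial must be divisible by a generator \<open>x\<^sup>a y\<^sup>b\<close> with \<open>(a, b) \<in> T\<close>. In this form the
  intersection of two monomial ideals becomes a question about exponents only.\<close>

definition monomial_ideal :: "(nat \<times> nat) set \<Rightarrow> 'k::field poly poly set" where
  "monomial_ideal T = {p. \<forall>i j. coef p i j \<noteq> 0 \<longrightarrow> (\<exists>(a, b)\<in>T. a \<le> i \<and> b \<le> j)}"

text \<open>A monomial of a product \<open>r * p\<close> is a multiple of some monomial of \<open>p\<close>, so it inherits the divisor
  in \<open>T\<close>.\<close>

lemma ideal_monomial_ideal: "ideal (monomial_ideal T :: 'k::field poly poly set) Kxy"
proof -
  have "r * p \<in> monomial_ideal T" if p: "p \<in> monomial_ideal T" for r p :: "'k poly poly"
    unfolding monomial_ideal_def mem_Collect_eq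
  proof (intro allI impI)
    fix i j assume "coef (r * p) i j \<noteq> 0"
    then obtain l where l: "l \<le> j" "(\<Sum>k\<le>i. coef r k l * coef p (i - k) (j - l)) \<noteq> 0"
      unfolding coef_mult by (metis (no_types, lifting) sum.neutral atMost_iff)
    then obtain k where "k \<le> i" "coef r k l * coef p (i - k) (j - l) \<noteq> 0"
      by (metis (no_types, lifting) sum.neutral atMost_iff)
    then obtain a b where "(a, b) \<in> T" "a \<le> i - k" "b \<le> j - l"
      using p by (fastforce simp: monomial_ideal_def)
    thus "\<exists>(a, b)\<in>T. a \<le> i \<and> b \<le> j"
      by (intro bexI[of _ "(a, b)"]) auto
  qed
  moreover have "p + q \<in> monomial_ideal T"
    if "p \<in> monomial_ideal T" "q \<in> monomial_ideal T" for p q :: "'k poly poly"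
    using that unfolding monomial_ideal_def mem_Collect_eq coef_add by (metis add.left_neutral)
  moreover have "(0 :: 'k poly poly) \<in> monomial_ideal T"
    by (simp add: monomial_ideal_def coef_0)
  ultimately show ?thesis
    unfolding ideal_of_type_iff by blast
qed

lemma genideal_monomials:
  "Idl\<^bsub>Kxy\<^esub> ((\<lambda>(a, b). xy a b) ` T) = (monomial_ideal T :: 'k::field poly poly set)"
proof
  show "Idl\<^bsub>Kxy\<^esub> ((\<lambda>(a, b). xy a b) ` T) \<subseteq> (monomial_ideal T :: 'k poly poly set)"
    by (intro genideal_of_type_minimal ideal_monomial_ideal)
      (auto simp: monomial_ideal_def coef_xy split: if_splits)
  show "(monomial_ideal T :: 'k poly poly set) \<subseteq> Idl\<^bsub>Kxy\<^esub> ((\<lambda>(a, b). xy a b) ` T)" (is "_ \<subseteq> ?I")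
  proof
    fix p :: "'k poly poly" assume p: "p \<in> monomial_ideal T"
    have I: "ideal ?I Kxy"
      by (rule ideal_genideal_of_type)
    have "[:[:coef p i j:]:] * xy i j \<in> ?I" for i j
    proof (cases "coef p i j = 0")
      case True
      thus ?thesis using I by (simp add: ideal_of_type_iff)
    next
      case False
      then obtain a b where ab: "(a, b) \<in> T" "a \<le> i" "b \<le> j"
        using p unfolding monomial_ideal_def by blast
      hence "xy a b \<in> ?I"
        using subset_genideal_of_type by fastforce
      moreover have "[:[:coef p i j:]:] * xy i j = ([:[:coef p i j:]:] * xy (i - a) (j - b)) * xy a b"
        using ab by (simp only: mult.assoc xy_mult) simp
      ultimately show ?thesis
        using I unfolding ideal_of_type_iff by metis
    qed
    thus "p \<in> ?I"
      by (subst poly_poly_as_sum) (intro ideal_of_type_sum[OF I])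
  qed
qed

section \<open>The component of lowest degree\<close>

text \<open>On polynomials without terms of degree below \<open>D\<close>, taking the component of degree \<open>D\<close> turns
  multiplication by \<open>r\<close> into scaling by the constant coefficient of \<open>r\<close>. Thus an ideal of such
  polynomials maps into the linear span of the images of its generators, and the number of
  generators is bounded below by the number of independent vectors found there.\<close>

lemma card_le_min_gens:
  fixes L :: "'k::field poly poly set"
  assumes order: "\<And>p i j. p \<in> L \<Longrightarrow> i + j < D \<Longrightarrow> coef p i j = 0"
    and C: "C \<subseteq> {..D}" "\<And>i. i \<in> C \<Longrightarrow> xy i (D - i) \<in> L"
  shows "enat (card C) \<le> min_gens Kxy L"
  unfolding min_gens_def
proof (rule INF_greatest, clarify)
  fix S :: "'k poly poly set" assume S: "finite S" "L = Idl\<^bsub>Kxy\<^esub> S"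
  interpret V: vector_space "smult :: 'k \<Rightarrow> 'k poly \<Rightarrow> 'k poly"
    by unfold_locales (simp_all add: smult_add_right smult_add_left)
  \<comment> \<open>A form of degree \<open>D\<close> is recorded by its dehomogenisation at \<open>y = 1\<close>, which loses nothing
     and lives in the vector space \<open>K[x]\<close>.\<close>
  define lowest :: "'k poly poly \<Rightarrow> 'k poly"
    where "lowest p = (\<Sum>i\<le>D. Polynomial.monom (coef p i (D - i)) i)" for p
  have lowest_add: "lowest (p + q) = lowest p + lowest q" for p q
    by (simp add: lowest_def coef_add add_monom[symmetric] sum.distrib)
  have lowest_xy: "lowest (xy i (D - i)) = Polynomial.monom 1 i" if "i \<le> D" for i
  proof -
    have "lowest (xy i (D - i)) = (\<Sum>k\<le>D. if k = i then Polynomial.monom 1 i else 0)"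
      unfolding lowest_def by (rule sum.cong) (auto simp: coef_xy)
    thus ?thesis using that by simp
  qed
  have coef_mult_low: "coef (r * p) i j = coef r 0 0 * coef p i j"
    if "\<And>i j. i + j < D \<Longrightarrow> coef p i j = 0" "i + j \<le> D" for r p :: "'k poly poly" and i j
  proof -
    have "coef (r * p) i j =
        (\<Sum>l\<le>j. \<Sum>k\<le>i. if l = 0 then if k = 0 then coef r 0 0 * coef p i j else 0 else 0)"
      unfolding coef_mult by (intro sum.cong refl) (use that in auto)
    also have "\<dots> = (\<Sum>l\<le>j. if l = 0 then coef r 0 0 * coef p i j else 0)"
      by (intro sum.cong refl) auto
    finally show ?thesis by simp
  qed
  have lowest_mult: "lowest (r * p) = smult (coef r 0 0) (lowest p)"
    if "\<And>i j. i + j < D \<Longrightarrow> coef p i j = 0" for r p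
  proof -
    have "lowest (r * p) = (\<Sum>i\<le>D. smult (coef r 0 0) (Polynomial.monom (coef p i (D - i)) i))"
      unfolding lowest_def by (intro sum.cong refl) (simp add: coef_mult_low that smult_monom)
    thus ?thesis
      by (simp add: lowest_def V.scale_sum_right)
  qed
  let ?N = "{p. (\<forall>i j. i + j < D \<longrightarrow> coef p i j = 0) \<and> lowest p \<in> V.span (lowest ` S)}"
  have "lowest 0 = 0"
    by (simp add: lowest_def coef_0)
  hence "ideal ?N Kxy"
    unfolding ideal_of_type_iff
    by (auto simp: coef_0 coef_add lowest_add coef_mult_low lowest_mult
        intro: V.span_zero V.span_add V.span_scale)
  moreover have "S \<subseteq> ?N"
    using order subset_genideal_of_type[of S] by (auto simp: S(2) intro: V.span_base)
  ultimately have L: "L \<subseteq> ?N"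
    unfolding S(2) by (rule genideal_of_type_minimal)
  \<comment> \<open>The monomials with exponents in \<open>C\<close> are independent vectors inside that span.\<close>
  have "(\<lambda>i. Polynomial.monom 1 i) ` C \<subseteq> V.span (lowest ` S)"
  proof clarify
    fix i assume i: "i \<in> C"
    hence "lowest (xy i (D - i)) \<in> V.span (lowest ` S)"
      using L C(2)[OF i] by blast
    thus "Polynomial.monom 1 i \<in> V.span (lowest ` S)"
      using i C(1) by (auto simp: lowest_xy)
  qed
  moreover have "V.independent ((\<lambda>i. Polynomial.monom 1 i) ` C)"
    unfolding V.dependent_def
  proof clarify
    fix i assume i: "Polynomial.monom 1 i \<in>
      V.span ((\<lambda>i. Polynomial.monom 1 i) ` C - {Polynomial.monom (1::'k) i})"
    have "V.span ((\<lambda>i. Polynomial.monom 1 i) ` C - {Polynomial.monom (1::'k) i}) \<subseteq>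
        {p. Polynomial.coeff p i = 0}"
      by (rule V.span_minimal) (auto simp: V.subspace_def)
    thus False using i by auto
  qed
  ultimately have "card ((\<lambda>i. Polynomial.monom (1::'k) i) ` C) \<le> card (lowest ` S)"
    using V.independent_span_bound S(1) by blast
  moreover have "card ((\<lambda>i. Polynomial.monom (1::'k) i) ` C) = card C"
    by (rule card_image) (simp add: inj_on_def monom_eq_iff')
  moreover have "card (lowest ` S) \<le> card S"
    by (rule card_image_le[OF S(1)])
  ultimately show "enat (card C) \<le> enat (card S)"
    by simp
qed

section \<open>Generators of an intersection\<close>

definition antidiagonal :: "nat \<Rightarrow> nat set \<Rightarrow> (nat \<times> nat) set" where
  "antidiagonal d A = (\<lambda>a. (a, d - a)) ` A"

text \<open>In column \<open>i\<close>, the staircase of the ideal with exponents \<open>A\<close> has height \<open>d - a\<close>, where \<open>a\<close> is the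
  largest element of \<open>A\<close> up to \<open>i\<close>. The staircase of the intersection is the maximum of the two
  heights; it is constant between consecutive elements of \<open>A \<union> B\<close>, so one generator for each
  element of \<open>A \<union> B\<close> suffices. Some of these generators may be redundant.\<close>

lemma min_gens_inter_le:
  assumes "finite A" "0 \<in> A" "finite B" "0 \<in> B"
  shows "min_gens Kxy ((monomial_ideal (antidiagonal d A) :: 'k::field poly poly set) \<inter>
           monomial_ideal (antidiagonal e B)) \<le> enat (card (A \<union> B))"
proof -
  define top where "top U i = Max {a \<in> U. a \<le> i}" for U and i :: nat
  have top_in: "top U i \<in> U \<and> top U i \<le> i" if "finite U" "0 \<in> U" for U i
    using Max_in[of "{a \<in> U. a \<le> i}"] that unfolding top_def by fastforce
  have top_ge: "a \<le> top U i" if "finite U" "a \<in> U" "a \<le> i" for U i a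
    using that unfolding top_def by (intro Max_ge) auto
  \<comment> \<open>\<open>g i\<close> is the lowest point of column \<open>i\<close> that lies in both ideals.\<close>
  define g where "g i = (i, max (d - top A i) (e - top B i))" for i
  have above_iff: "(\<exists>(a, b)\<in>g ` (A \<union> B). a \<le> i \<and> b \<le> j) \<longleftrightarrow>
     (\<exists>(a, b)\<in>antidiagonal d A. a \<le> i \<and> b \<le> j) \<and> (\<exists>(a, b)\<in>antidiagonal e B. a \<le> i \<and> b \<le> j)"
    (is "?L \<longleftrightarrow> ?R") for i j
  proof
    assume ?L
    then obtain k where "k \<in> A \<union> B" "k \<le> i" "d - top A k \<le> j" "e - top B k \<le> j"
      by (auto simp: g_def)
    moreover have "top A k \<in> A" "top A k \<le> k" "top B k \<in> B" "top B k \<le> k"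
      using top_in assms by auto
    ultimately show ?R
      unfolding antidiagonal_def by (auto intro: order.trans)
  next
    assume ?R
    then obtain a b where ab: "a \<in> A" "a \<le> i" "d - a \<le> j" "b \<in> B" "b \<le> i" "e - b \<le> j"
      by (auto simp: antidiagonal_def)
    \<comment> \<open>The column of the least common multiple of the two generators belongs to \<open>A\<close> or \<open>B\<close>.\<close>
    let ?k = "max a b"
    have "a \<le> top A ?k" "b \<le> top B ?k"
      using ab assms by (auto intro: top_ge)
    hence "d - top A ?k \<le> j" "e - top B ?k \<le> j"
      using ab by linarith+
    moreover have "?k \<in> A \<union> B" "?k \<le> i"
      using ab by (auto simp: max_def)
    ultimately show ?L
      by (intro bexI[of _ "g ?k"]) (auto simp: g_def)
  qed
  have "(monomial_ideal (antidiagonal d A) :: 'k poly poly set) \<inter>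
           monomial_ideal (antidiagonal e B) = monomial_ideal (g ` (A \<union> B))"
    unfolding monomial_ideal_def above_iff by blast
  also have "\<dots> = Idl\<^bsub>Kxy\<^esub> ((\<lambda>(a, b). xy a b) ` g ` (A \<union> B))"
    by (rule genideal_monomials[symmetric])
  finally have "min_gens Kxy ((monomial_ideal (antidiagonal d A) :: 'k poly poly set) \<inter>
           monomial_ideal (antidiagonal e B)) \<le>
         enat (card ((\<lambda>(a, b). xy a b :: 'k poly poly) ` g ` (A \<union> B)))"
    unfolding min_gens_def using assms by (intro INF_lower) auto
  also have "card ((\<lambda>(a, b). xy a b :: 'k poly poly) ` g ` (A \<union> B)) \<le> card (A \<union> B)"
    unfolding image_image using assms by (intro card_image_le) auto
  finally show ?thesis by simp
qed

section \<open>Generators of a product\<close>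

lemma card_sumset_le_min_gens_prod:
  assumes "A \<subseteq> {..d}" "B \<subseteq> {..e}"
  shows "enat (card ((\<lambda>(a, b). a + b) ` (A \<times> B))) \<le>
    min_gens Kxy ((monomial_ideal (antidiagonal d A) :: 'k::field poly poly set) \<cdot>\<^bsub>Kxy\<^esub>
           monomial_ideal (antidiagonal e B))" (is "_ \<le> min_gens _ (?I \<cdot>\<^bsub>Kxy\<^esub> ?J)")
proof (rule card_le_min_gens[where D = "d + e"])
  have low: "coef p i j = 0" if p: "p \<in> monomial_ideal (antidiagonal n U)" and ij: "i + j < n"
    for p :: "'k poly poly" and n U i j
  proof (rule ccontr)
    assume "coef p i j \<noteq> 0"
    then obtain a b where "(a, b) \<in> antidiagonal n U" "a \<le> i" "b \<le> j"
      using p unfolding monomial_ideal_def by blast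
    thus False using ij by (auto simp: antidiagonal_def)
  qed
  show "coef p i j = 0" if "p \<in> ?I \<cdot>\<^bsub>Kxy\<^esub> ?J" "i + j < d + e" for p i j
    using that(1)
  proof induction
    case (prod u v)
    have "coef u k l * coef v (i - k) (j - l) = 0" if "k \<le> i" "l \<le> j" for k l
    proof (cases "k + l < d")
      case False
      hence "(i - k) + (j - l) < e"
        using that \<open>i + j < d + e\<close> by linarith
      thus ?thesis using low[OF prod(2)] by simp
    qed (simp add: low[OF prod(1)])
    thus ?case
      unfolding ring_of_type_algebra_simps coef_mult by (intro sum.neutral ballI) auto
  qed (simp add: coef_add)
  show "(\<lambda>(a, b). a + b) ` (A \<times> B) \<subseteq> {..d + e}"
    using assms by (fastforce intro: add_mono)
  fix i assume "i \<in> (\<lambda>(a, b). a + b) ` (A \<times> B)"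
  then obtain a b where ab: "a \<in> A" "b \<in> B" "i = a + b" by auto
  hence "xy a (d - a) \<in> ?I" "xy b (e - b) \<in> ?J"
    by (auto simp: monomial_ideal_def antidiagonal_def coef_xy)
  hence "xy a (d - a) * xy b (e - b) \<in> ?I \<cdot>\<^bsub>Kxy\<^esub> ?J"
    using ideal_prod.prod[of _ ?I _ ?J Kxy] by simp
  moreover have "a \<le> d" "b \<le> e" using ab assms by auto
  ultimately show "xy i (d + e - i) \<in> ?I \<cdot>\<^bsub>Kxy\<^esub> ?J"
    by (simp add: xy_mult ab(3))
qed

section \<open>Equigenerated monomial ideals of height two\<close>

text \<open>The case of Krull's principal ideal theorem that is needed here. A prime ideal strictly inside
  \<open>(t)\<close> does not contain \<open>t\<close>, so with \<open>t * h\<close> it contains \<open>h\<close>; its elements are therefore divisible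
  by all powers of \<open>t\<close>, hence zero by assumption, and no smaller prime ideal is left for a chain.\<close>

lemma ideal_height_le_1:
  fixes t :: "'a::idom"
  assumes t: "prime_elem t" and powers: "\<And>f. (\<And>n. t ^ n dvd f) \<Longrightarrow> f = 0"
    and I: "I \<subseteq> {f. t dvd f}"
  shows "ideal_height (ring_of_type_algebra :: 'a ring) I \<le> 1"
proof -
  let ?R = "ring_of_type_algebra :: 'a ring"
  let ?P = "{f. t dvd f}"
  have "ideal ?P ?R"
    by (auto simp: ideal_of_type_iff)
  moreover have "?P \<noteq> UNIV"
    using t by (auto simp: prime_elem_def)
  ultimately have "primeideal ?P ?R"
    using t by (intro primeidealI cring_from_type_algebra) (auto dest: prime_elem_dvd_multD)
  hence "ideal_height ?R I \<le> prime_height ?R ?P"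
    unfolding ideal_height_def using I by (intro INF_lower) auto
  also have "\<dots> \<le> 1"
    unfolding prime_height_def
  proof (rule SUP_least, clarify)
    fix n C
    assume prime: "\<forall>i\<le>n. primeideal (C i) ?R" and chain: "\<forall>i<n. C i \<subset> C (Suc i)"
      and last: "C n = ?P"
    have "n \<le> 1"
    proof (rule ccontr)
      assume "\<not> n \<le> 1"
      then obtain m where n: "n = Suc (Suc m)"
        by (metis One_nat_def Suc_le_mono le0 not0_implies_Suc not_less_eq_eq)
      let ?Q = "C (Suc m)"
      interpret Q: primeideal ?Q ?R using prime n by simp
      have Q: "ideal ?Q ?R" by (rule Q.is_ideal)
      have sub: "?Q \<subset> ?P" using chain n last by (metis lessI)
      have "t \<notin> ?Q"
      proof
        assume "t \<in> ?Q"
        hence "r * t \<in> ?Q" for r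
          using Q by (auto simp: ideal_of_type_iff)
        hence "?P \<subseteq> ?Q" by (metis (no_types, lifting) dvdE mem_Collect_eq mult.commute subsetI)
        thus False using sub by blast
      qed
      have "t ^ k dvd f" if "f \<in> ?Q" for k f
        using that
      proof (induction k arbitrary: f)
        case (Suc k)
        hence "t dvd f" using sub by blast
        then obtain h where h: "f = t * h" by (rule dvdE)
        hence "h \<in> ?Q"
          using Suc.prems \<open>t \<notin> ?Q\<close> Q.I_prime[of t h] by auto
        thus ?case using Suc.IH h by (simp add: mult_dvd_mono)
      qed simp
      hence "?Q \<subseteq> {0}" using powers by blast
      moreover have "C m \<subset> ?Q" using chain n by simp
      moreover have "0 \<in> C m"
        using prime n unfolding primeideal_def ideal_of_type_iff by simp
      ultimately show False by blast
    qed
    thus "enat n \<le> 1"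
      by (simp add: one_enat_def)
  qed
  finally show ?thesis .
qed

lemma var_y_ideal_height:
  assumes "I \<subseteq> {f. var_y dvd f}"
  shows "ideal_height (Kxy :: 'k::field poly poly ring) I \<le> 1"
proof (rule ideal_height_le_1[OF _ _ assms])
  have "[:0, 1:] dvd f \<longleftrightarrow> poly f 0 = 0" for f :: "'k poly poly"
    by (simp add: poly_eq_0_iff_dvd)
  thus "prime_elem (var_y :: 'k poly poly)"
    unfolding var_y_def by (auto simp: prime_elem_def)
  \<comment> \<open>Divisibility by \<open>y\<^bsup>j+1\<^esup>\<close> kills all coefficients with \<open>y\<close>-exponent \<open>j\<close>.\<close>
  show "f = 0" if dvd: "\<And>n. var_y ^ n dvd f" for f :: "'k poly poly"
  proof (rule poly_poly_eqI)
    fix i j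
    obtain g where "f = xy 0 (Suc j) * g"
      using dvd[of "Suc j"] by (auto simp: xy_def elim: dvdE)
    thus "coef f i j = coef 0 i j" by (simp add: coef_xy_mult coef_0)
  qed
qed

lemma var_x_ideal_height:
  assumes "I \<subseteq> {f. var_x dvd f}"
  shows "ideal_height (Kxy :: 'k::field poly poly ring) I \<le> 1"
proof (rule ideal_height_le_1[OF _ _ assms])
  have "[:0, 1:] dvd f \<longleftrightarrow> poly f 0 = 0" for f :: "'k poly"
    by (simp add: poly_eq_0_iff_dvd)
  hence "prime_elem [:0, 1 :: 'k:]"
    by (auto simp: prime_elem_def)
  thus "prime_elem (var_x :: 'k poly poly)"
    unfolding var_x_def by (rule lift_prime_elem_poly)
  \<comment> \<open>Divisibility by \<open>x\<^bsup>i+1\<^esup>\<close> kills all coefficients with \<open>x\<close>-exponent \<open>i\<close>.\<close>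
  show "f = 0" if dvd: "\<And>n. var_x ^ n dvd f" for f :: "'k poly poly"
  proof (rule poly_poly_eqI)
    fix i j
    obtain g where "f = xy (Suc i) 0 * g"
      using dvd[of "Suc i"] by (auto simp: xy_def elim: dvdE)
    thus "coef f i j = coef 0 i j" by (simp add: coef_xy_mult coef_0)
  qed
qed

text \<open>If every generator were divisible by \<open>x\<close>, the height would be at most \<open>1\<close>; so a power of \<open>y\<close> is a
  generator, which is \<open>0 \<in> A\<close>. Symmetrically, \<open>d \<in> A\<close>. The case \<open>d = 0\<close> is the unit ideal, whose
  height is \<open>\<infinity>\<close> by convention, so that height \<open>2\<close> excludes it too.\<close>

lemma height_2_generators:
  fixes I :: "'k::field poly poly set"
  assumes "equigenerated_monomial_ideal I" and height: "ideal_height Kxy I = 2"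
  obtains d A where "0 < d" "A \<subseteq> {..d}" "0 \<in> A" "d \<in> A" "I = monomial_ideal (antidiagonal d A)"
proof -
  obtain d S where S: "S \<subseteq> monomials_of_degree d" "I = Idl\<^bsub>Kxy\<^esub> S"
    using assms(1) by (auto simp: equigenerated_monomial_ideal_def)
  define A where "A = {a. a \<le> d \<and> xy a (d - a) \<in> S}"
  have S_eq: "S = (\<lambda>(a, b). xy a b) ` antidiagonal d A"
    using S(1) by (fastforce simp: A_def antidiagonal_def monomials_of_degree_def xy_def)
  have ideal_dvd: "ideal {f. t dvd f} Kxy" for t :: "'k poly poly"
    by (auto simp: ideal_of_type_iff)
  have small: "\<not> (2::enat) \<le> 1"
    by (simp add: one_enat_def numeral_eq_enat)
  have "\<not> S \<subseteq> {f. var_x dvd f}"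
    using var_x_ideal_height[of I] genideal_of_type_minimal[OF ideal_dvd] height small S(2) by metis
  then obtain a where "a \<in> A" "\<not> var_x dvd (xy a (d - a) :: 'k poly poly)"
    unfolding S_eq antidiagonal_def by auto
  hence "0 \<in> A"
    by (cases a) (auto simp: xy_def)
  have "\<not> S \<subseteq> {f. var_y dvd f}"
    using var_y_ideal_height[of I] genideal_of_type_minimal[OF ideal_dvd] height small S(2) by metis
  then obtain a where "a \<in> A" "\<not> var_y dvd (xy a (d - a) :: 'k poly poly)"
    unfolding S_eq antidiagonal_def by auto
  hence "d \<in> A"
    by (cases "d - a") (auto simp: xy_def A_def)
  have "0 < d"
  proof (rule ccontr)
    assume "\<not> 0 < d"
    hence "1 \<in> I"
      using \<open>0 \<in> A\<close> subset_genideal_of_type[of S] by (auto simp: A_def S(2) xy_def)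
    hence "P = UNIV" if "ideal P Kxy" "I \<subseteq> P" for P
      using that unfolding ideal_of_type_iff by (metis UNIV_eq_I mult.right_neutral subsetD)
    hence "{P. primeideal P Kxy \<and> I \<subseteq> P} = {}"
      using primeideal.I_notcarr primeideal.axioms(1)
      by (metis (mono_tags, lifting) empty_Collect_eq ring_of_type_algebra_simps(1))
    thus False
      using height unfolding ideal_height_def by (simp only: image_empty Inf_empty)
        (simp add: top_enat_def)
  qed
  moreover have "A \<subseteq> {..d}" by (auto simp: A_def)
  moreover have "I = monomial_ideal (antidiagonal d A)"
    using S(2) S_eq genideal_monomials by metis
  ultimately show ?thesis
    using that \<open>0 \<in> A\<close> \<open>d \<in> A\<close> by blast
qed

section \<open>The inequality\<close>

lemma card_union_less_card_sumset:
  fixes A B :: "nat set"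
  assumes "A \<subseteq> {..d}" "0 \<in> A" "d \<in> A" "0 < d" "B \<subseteq> {..e}" "0 \<in> B" "e \<in> B" "0 < e"
  shows "card (A \<union> B) < card ((\<lambda>(a, b). a + b) ` (A \<times> B))"
proof (rule psubset_card_mono)
  show "finite ((\<lambda>(a, b). a + b) ` (A \<times> B))"
    using assms finite_subset[of _ "{.._}"] by blast
  have "A \<union> B \<subseteq> (\<lambda>(a, b). a + b) ` (A \<times> B)"
    using assms by force
  moreover have "d + e \<in> (\<lambda>(a, b). a + b) ` (A \<times> B)" "d + e \<notin> A \<union> B"
    using assms by force+
  ultimately show "A \<union> B \<subset> (\<lambda>(a, b). a + b) ` (A \<times> B)"
    by blast
qed

theorem corollary3p2:
  fixes I J :: "'k::field poly poly set"
  assumes "equigenerated_monomial_ideal I" and "ideal_height Kxy I = 2"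
    and "equigenerated_monomial_ideal J" and "ideal_height Kxy J = 2"
  shows "min_gens Kxy (I \<inter> J) < min_gens Kxy (I \<cdot>\<^bsub>Kxy\<^esub> J)"
proof -
  obtain d A where A: "0 < d" "A \<subseteq> {..d}" "0 \<in> A" "d \<in> A" "I = monomial_ideal (antidiagonal d A)"
    using height_2_generators[OF assms(1,2)] .
  obtain e B where B: "0 < e" "B \<subseteq> {..e}" "0 \<in> B" "e \<in> B" "J = monomial_ideal (antidiagonal e B)"
    using height_2_generators[OF assms(3,4)] .
  have "min_gens Kxy (I \<inter> J) \<le> enat (card (A \<union> B))"
    unfolding A(5) B(5) by (intro min_gens_inter_le) (use A B finite_subset in auto)
  also have "\<dots> < enat (card ((\<lambda>(a, b). a + b) ` (A \<times> B)))"
    using card_union_less_card_sumset A B by simp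
  also have "\<dots> \<le> min_gens Kxy (I \<cdot>\<^bsub>Kxy\<^esub> J)"
    unfolding A(5) B(5) by (rule card_sumset_le_min_gens_prod[OF A(2) B(2)])
  finally show ?thesis .
qed

end
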